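(* Each Hausdorff $\sigma$-compact feebly compact paratopological group is a compact topological group.
   Context: A paratopological group is a group with a topology such that the multiplication is continuous; it is a topological group if moreover inversion is continuous. A space is feebly compact if each locally finite family of its open subsets is finite. A space is $\sigma$-compact if it is a countable union of compact subsets. *)

theory Defs
  imports "HOL-Analysis.Analysis" "HOL-Algebra.Group"
begin

definition paratopological_group :: "('a, 'b) monoid_scheme \<Rightarrow> 'a topology \<Rightarrow> bool"
  where "paratopological_group G T \<longleftrightarrow>
    Group.group G \<and> topspace T = carrier G \<and>
    continuous_map (prod_topology T T) T (\<lambda>(x, y). x \<otimes>\<^bsub>G\<^esub> y)"

definition topological_group :: "('a, 'b) monoid_scheme \<Rightarrow> 'a topology \<Rightarrow> bool"
  where "topological_group G T \<longleftrightarrow>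
    paratopological_group G T \<and> continuous_map T T (\<lambda>x. inv\<^bsub>G\<^esub> x)"

(* Families are sets of open sets, so the empty set can occur in a family at most once and
   does not affect its finiteness. *)
definition feebly_compact_space :: "'a topology \<Rightarrow> bool"
  where "feebly_compact_space T \<longleftrightarrow>
    (\<forall>\<U>. (\<forall>U\<in>\<U>. openin T U) \<and> locally_finite_in T \<U> \<longrightarrow> finite \<U>)"

definition sigma_compact_space :: "'a topology \<Rightarrow> bool"
  where "sigma_compact_space T \<longleftrightarrow>
    (\<exists>\<K>. countable \<K> \<and> (\<forall>K\<in>\<K>. compactin T K) \<and> \<Union>\<K> = topspace T)"

end

theory Submission
  imports Defs "HOL-Algebra.Coset"
begin

no_notation eq_closure_of (\<open>closure'_of\<index>\<close>)

text \<open>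
  Let \<open>T'\<close> be the semiregularization of \<open>T\<close>, generated by the interiors of closures of
  \<open>T\<close>-open sets. It is again a Hausdorff paratopological group topology, and since
  \<open>V W \<subseteq> U\<close> with \<open>W\<close> a neighbourhood of the identity puts the closure of \<open>V\<close> inside
  the open subset \<open>closure V \<cdot> W\<close> of the closure of \<open>U\<close>, feeble compactness and the Lindelof
  property make \<open>T'\<close> compact. By Baire's theorem one of the countably many \<open>T\<close>-compact sets
  covering \<open>G\<close> has non-empty \<open>T'\<close>-interior. Both topologies agree on that compact set, hence,
  by translation, everywhere. Finally, in a compact Hausdorff paratopological group the graph of
  inversion is closed, so that inversion is continuous.
\<close>

section \<open>Semiregularization\<close>

text \<open>The regular open sets form a base of this topology. Spelling out its open sets, instead
  of generating it from the base, gives a direct openness criterion and makes it visibly coarser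
  than \<open>T\<close>.\<close>

definition semiregularization :: "'a topology \<Rightarrow> 'a topology"
  where "semiregularization T = topology (\<lambda>S. openin T S \<and>
    (\<forall>x\<in>S. \<exists>U. openin T U \<and> x \<in> U \<and> T interior_of (T closure_of U) \<subseteq> S))"

text \<open>The definition through \<open>topology\<close> is usable only after
  \<open>istopology\<close> is checked. For intersections, \<open>U \<inter> V\<close> is a witness
  because interior and closure are monotone.\<close>

lemma openin_semiregularization:
  "openin (semiregularization T) S \<longleftrightarrow> openin T S \<and>
    (\<forall>x\<in>S. \<exists>U. openin T U \<and> x \<in> U \<and> T interior_of (T closure_of U) \<subseteq> S)"
proof -
  define P where "P S \<longleftrightarrow> openin T S \<and>
    (\<forall>x\<in>S. \<exists>U. openin T U \<and> x \<in> U \<and> T interior_of (T closure_of U) \<subseteq> S)" for S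
  have "istopology P"
    unfolding istopology_def
  proof (intro conjI allI impI)
    fix A B assume A: "P A" and B: "P B"
    have "\<exists>U. openin T U \<and> x \<in> U \<and> T interior_of (T closure_of U) \<subseteq> A \<inter> B"
      if x: "x \<in> A \<inter> B" for x
    proof -
      obtain U where U: "openin T U" "x \<in> U" "T interior_of (T closure_of U) \<subseteq> A"
        using A x unfolding P_def by blast
      obtain V where V: "openin T V" "x \<in> V" "T interior_of (T closure_of V) \<subseteq> B"
        using B x unfolding P_def by blast
      have "T interior_of (T closure_of (U \<inter> V)) \<subseteq> T interior_of (T closure_of U)"
        "T interior_of (T closure_of (U \<inter> V)) \<subseteq> T interior_of (T closure_of V)"
        by (simp_all add: closure_of_mono interior_of_mono)
      then show ?thesis
        using U V by (intro exI[of _ "U \<inter> V"]) auto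
    qed
    then show "P (A \<inter> B)"
      using A B unfolding P_def by (meson openin_Int)
  next
    fix \<K> assume \<K>: "\<forall>K\<in>\<K>. P K"
    then have "openin T (\<Union>\<K>)"
      by (auto simp: P_def)
    moreover have "\<exists>U. openin T U \<and> x \<in> U \<and> T interior_of (T closure_of U) \<subseteq> \<Union>\<K>"
      if "x \<in> \<Union>\<K>" for x
      using that \<K> unfolding P_def by (meson UnionE Union_upper subset_trans)
    ultimately show "P (\<Union>\<K>)"
      by (simp add: P_def)
  qed
  moreover have "semiregularization T = topology P"
    unfolding semiregularization_def P_def ..
  ultimately show ?thesis
    by (simp add: topology_inverse' P_def)
qed

lemma openin_semiregularization_imp_openin:
  "openin (semiregularization T) S \<Longrightarrow> openin T S"
  by (simp add: openin_semiregularization)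

text \<open>Taking the interior of the closure is idempotent, so \<open>?W\<close> is its own
  witness at each of its points.\<close>

lemma openin_semiregularization_interior_closure:
  "openin (semiregularization T) (T interior_of (T closure_of U))" (is "openin _ ?W")
proof -
  have "T closure_of ?W \<subseteq> T closure_of U"
    by (simp add: closure_of_minimal interior_of_subset)
  then have "T interior_of (T closure_of ?W) \<subseteq> ?W"
    by (rule interior_of_mono)
  then show ?thesis
    unfolding openin_semiregularization using openin_interior_of by blast
qed

lemma topspace_semiregularization [simp]: "topspace (semiregularization T) = topspace T"
proof
  show "topspace (semiregularization T) \<subseteq> topspace T"
    by (meson openin_semiregularization_imp_openin openin_subset openin_topspace)
  have "openin (semiregularization T) (topspace T)"
    using openin_semiregularization_interior_closure[of T "topspace T"] by simp
  then show "topspace T \<subseteq> topspace (semiregularization T)"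
    by (rule openin_subset)
qed

lemma subset_interior_closure: "openin T U \<Longrightarrow> U \<subseteq> T interior_of (T closure_of U)"
  by (simp add: closure_of_subset interior_of_maximal openin_subset)

text \<open>Disjoint open sets have disjoint regular hulls: an open set that misses \<open>V\<close>
  misses the closure of \<open>V\<close>. This is applied twice, first to enlarge \<open>V\<close>
  to \<open>?V\<close>, then to enlarge \<open>U\<close> against the open set
  \<open>?V\<close>.\<close>

lemma Hausdorff_space_semiregularization:
  assumes "Hausdorff_space T"
  shows "Hausdorff_space (semiregularization T)"
  unfolding Hausdorff_space_def
proof (intro allI impI)
  fix x y
  assume "x \<in> topspace (semiregularization T) \<and> y \<in> topspace (semiregularization T) \<and> x \<noteq> y"
  then obtain U V where UV: "openin T U" "openin T V" "x \<in> U" "y \<in> V" "disjnt U V"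
    using assms unfolding Hausdorff_space_def topspace_semiregularization by meson
  let ?U = "T interior_of (T closure_of U)" and ?V = "T interior_of (T closure_of V)"
  have "U \<inter> T closure_of V = {}"
    using UV openin_Int_closure_of_eq_empty by (metis disjnt_def)
  then have "U \<inter> ?V = {}"
    using interior_of_subset by fastforce
  then have "?V \<inter> T closure_of U = {}"
    using openin_Int_closure_of_eq_empty[of T ?V U] by (simp add: inf_commute)
  then have "disjnt ?U ?V"
    using interior_of_subset[of T "T closure_of U"] unfolding disjnt_def by blast
  then show "\<exists>U V. openin (semiregularization T) U \<and> openin (semiregularization T) V \<and>
      x \<in> U \<and> y \<in> V \<and> disjnt U V"
    using UV openin_semiregularization_interior_closure subset_interior_closure by (meson subsetD)
qed

section \<open>Feeble compactness and the Lindelof property\<close>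

lemma sigma_compact_imp_Lindelof_space:
  assumes "sigma_compact_space T"
  shows "Lindelof_space T"
proof -
  obtain \<K> where \<K>: "countable \<K>" "\<And>K. K \<in> \<K> \<Longrightarrow> compactin T K" "\<Union>\<K> = topspace T"
    using assms unfolding sigma_compact_space_def by metis
  have "Lindelof_space (subtopology T (\<Union>\<K>))"
    by (rule Lindelof_space_Union[OF \<K>(1)])
      (simp add: \<K>(2) compact_imp_Lindelof_space compact_space_subtopology)
  then show ?thesis
    by (simp add: \<K>)
qed

text \<open>Remove from the space the closures of the first members of a countable subcover. The
  decreasing open remainders form a locally finite family, so only finitely many are distinct and
  they become constant; as no point lies in all of them, they end at the empty set.\<close>

lemma feebly_compact_Lindelof_finite_closures_cover:
  assumes fc: "feebly_compact_space T" and L: "Lindelof_space T"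
    and \<U>: "\<And>U. U \<in> \<U> \<Longrightarrow> openin T U" "\<Union>\<U> = topspace T"
  obtains \<F> where "finite \<F>" "\<F> \<subseteq> \<U>" "topspace T \<subseteq> (\<Union>U\<in>\<F>. T closure_of U)"
proof -
  obtain \<V> where \<V>: "countable \<V>" "\<V> \<subseteq> \<U>" "\<Union>\<V> = topspace T"
    using Lindelof_spaceD[OF L \<U>] by metis
  show thesis
  proof (cases "\<V> = {}")
    case True
    then show ?thesis
      using \<V> that[of "{}"] by auto
  next
    case False
    \<comment> \<open>An enumeration, possibly with repetitions, which exists since
      \<open>\<V>\<close> is non-empty here.\<close>
    define V where "V = from_nat_into \<V>"
    have range_V: "range V = \<V>"
      unfolding V_def using False \<V>(1) by (rule range_from_nat_into)
    define W where "W n = topspace T - (\<Union>i\<le>n. T closure_of V i)" for n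
    have disj: "W n \<inter> V i = {}" if "i \<le> n" for i n
    proof -
      have "V i \<subseteq> T closure_of V i"
        using range_V \<V>(2) \<U>(1) by (intro closure_of_subset openin_subset) auto
      then show ?thesis
        using that unfolding W_def by blast
    qed
    have ex: "\<exists>k. x \<in> V k" if "x \<in> topspace T" for x
      using that \<V>(3) range_V by blast
    have W_anti: "W n \<subseteq> W m" if "m \<le> n" for m n
      using that unfolding W_def by fastforce
    have "openin T (W n)" for n
      unfolding W_def by (intro openin_diff openin_topspace closedin_Union) auto
    \<comment> \<open>The neighbourhood \<open>V k\<close> of a point meets \<open>W n\<close> only
      for \<open>n < k\<close>.\<close>
    moreover have "locally_finite_in T (range W)"
      unfolding locally_finite_in_def
    proof (intro conjI ballI)
      show "\<Union> (range W) \<subseteq> topspace T"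
        unfolding W_def by blast
      fix x assume "x \<in> topspace T"
      then obtain k where k: "x \<in> V k"
        using ex by blast
      have "U \<in> W ` {..<k}" if U: "U \<in> range W" "U \<inter> V k \<noteq> {}" for U
      proof -
        obtain n where n: "U = W n"
          using U(1) by blast
        then have "n < k"
          using U(2) disj[of k n] by (meson not_le)
        then show ?thesis
          using n by blast
      qed
      then have "{U \<in> range W. U \<inter> V k \<noteq> {}} \<subseteq> W ` {..<k}"
        by blast
      then have "finite {U \<in> range W. U \<inter> V k \<noteq> {}}"
        by (rule finite_subset) simp
      moreover have "openin T (V k)"
        using range_V \<V>(2) \<U>(1) by auto
      ultimately show "\<exists>V. openin T V \<and> x \<in> V \<and> finite {U \<in> range W. U \<inter> V \<noteq> {}}"
        using k by blast
    qed
    ultimately have "finite (range W)"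
      using fc unfolding feebly_compact_space_def by blast
    \<comment> \<open>Finitely many indices realise all values of \<open>W\<close>. Since
      \<open>W\<close> is decreasing, \<open>W (Max A)\<close> is the smallest value and lies in
      every \<open>W k\<close>.\<close>
    then obtain A where A: "finite A" "range W = W ` A"
      using finite_subset_image[of "range W" W UNIV] by blast
    have "W (Max A) = {}"
    proof (rule ccontr)
      assume "W (Max A) \<noteq> {}"
      then obtain x where x: "x \<in> W (Max A)"
        by blast
      then obtain k where k: "x \<in> V k"
        using ex unfolding W_def by blast
      obtain a where "a \<in> A" "W k = W a"
        using A(2) by (metis imageE rangeI)
      then have "x \<in> W k"
        using x W_anti A(1) Max_ge by blast
      then show False
        using k disj by blast
    qed
    then have "topspace T \<subseteq> (\<Union>U\<in>V ` {..Max A}. T closure_of U)"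
      unfolding W_def by blast
    then show ?thesis
      using that[of "V ` {..Max A}"] range_V \<V>(2) by blast
  qed
qed

text \<open>The assumption \<open>reg\<close> isolates what the group structure contributes;
  \<open>paratopological_group_closure_nbhd\<close> supplies it later.\<close>

lemma compact_space_semiregularization:
  assumes "feebly_compact_space T" "Lindelof_space T"
    and reg: "\<And>U x. \<lbrakk>openin T U; x \<in> U\<rbrakk> \<Longrightarrow>
      \<exists>V. openin T V \<and> x \<in> V \<and> T closure_of V \<subseteq> T interior_of (T closure_of U)"
  shows "compact_space (semiregularization T)"
  unfolding compact_space topspace_semiregularization
proof (intro allI impI, elim conjE)
  fix \<U>
  assume \<U>: "\<forall>U\<in>\<U>. openin (semiregularization T) U" "\<Union>\<U> = topspace T"
  \<comment> \<open>A refinement by sets whose closures still fit into members of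
    \<open>\<U>\<close>, so that a finite cover by closures yields a finite subcover of
    \<open>\<U>\<close>.\<close>
  define \<V> where "\<V> = {V. openin T V \<and> (\<exists>U\<in>\<U>. T closure_of V \<subseteq> U)}"
  have "\<exists>V\<in>\<V>. x \<in> V" if x: "x \<in> topspace T" for x
  proof -
    obtain U where U: "U \<in> \<U>" "x \<in> U"
      using x \<U>(2) by blast
    then obtain O' where O': "openin T O'" "x \<in> O'" "T interior_of (T closure_of O') \<subseteq> U"
      using \<U>(1) unfolding openin_semiregularization by blast
    then show ?thesis
      using reg[OF O'(1,2)] U(1) unfolding \<V>_def by blast
  qed
  moreover have open_V: "\<And>V. V \<in> \<V> \<Longrightarrow> openin T V"
    by (simp add: \<V>_def)
  ultimately have Un_V: "\<Union>\<V> = topspace T"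
    using openin_subset by blast
  obtain \<F> where \<F>: "finite \<F>" "\<F> \<subseteq> \<V>" "topspace T \<subseteq> (\<Union>V\<in>\<F>. T closure_of V)"
    using feebly_compact_Lindelof_finite_closures_cover[OF assms(1,2) open_V Un_V] by metis
  have "\<forall>V\<in>\<F>. \<exists>U\<in>\<U>. T closure_of V \<subseteq> U"
    using \<F>(2) unfolding \<V>_def by blast
  then obtain f where f: "\<And>V. V \<in> \<F> \<Longrightarrow> f V \<in> \<U> \<and> T closure_of V \<subseteq> f V"
    by metis
  have "topspace T \<subseteq> \<Union>(f ` \<F>)"
    using \<F>(3) f by fastforce
  moreover have "f ` \<F> \<subseteq> \<U>"
    using f by blast
  ultimately show "\<exists>\<F>. finite \<F> \<and> \<F> \<subseteq> \<U> \<and> \<Union>\<F> = topspace T"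
    using \<F>(1) \<U>(2) by (intro exI[of _ "f ` \<F>"]) auto
qed

section \<open>Paratopological groups\<close>

lemma paratopological_group_mult_nbhds:
  assumes "paratopological_group G T" "openin T U" "x \<in> carrier G" "y \<in> carrier G"
    and "x \<otimes>\<^bsub>G\<^esub> y \<in> U"
  obtains A B where "openin T A" "openin T B" "x \<in> A" "y \<in> B" "set_mult G A B \<subseteq> U"
proof -
  have top: "topspace T = carrier G"
    and cont: "continuous_map (prod_topology T T) T (\<lambda>(x, y). x \<otimes>\<^bsub>G\<^esub> y)"
    using assms(1) by (auto simp: paratopological_group_def)
  let ?S = "{p \<in> topspace (prod_topology T T). (\<lambda>(x, y). x \<otimes>\<^bsub>G\<^esub> y) p \<in> U}"
  have "(x, y) \<in> ?S"
    using assms top by simp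
  with openin_continuous_map_preimage[OF cont assms(2)]
  obtain A B where "openin T A" "openin T B" "x \<in> A" "y \<in> B" "A \<times> B \<subseteq> ?S"
    unfolding openin_prod_topology_alt by (elim allE impE exE conjE)
  then show thesis
    by (intro that[of A B]) (auto simp: set_mult_def)
qed

lemma paratopological_group_left_translation:
  assumes "paratopological_group G T" "a \<in> carrier G"
  shows "continuous_map T T (\<lambda>x. a \<otimes>\<^bsub>G\<^esub> x)"
proof -
  have "continuous_map T T ((\<lambda>(x, y). x \<otimes>\<^bsub>G\<^esub> y) \<circ> (\<lambda>x. (a, x)))"
    using assms unfolding paratopological_group_def
    by (intro continuous_map_compose[where X' = "prod_topology T T"])
      (auto simp: continuous_map_pairedI)
  then show ?thesis
    by (simp add: o_def)
qed

text \<open>The image of \<open>U\<close> is its preimage under translation by the fixed element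
  \<open>inv a\<close>, so continuity of translations is enough and continuity of inversion is not
  presupposed.\<close>

lemma openin_left_translation_image:
  assumes pg: "paratopological_group G T" and a: "a \<in> carrier G" and U: "openin T U"
  shows "openin T ((\<lambda>x. a \<otimes>\<^bsub>G\<^esub> x) ` U)"
proof -
  interpret Group.group G
    using pg by (simp add: paratopological_group_def)
  have top: "topspace T = carrier G"
    using pg by (simp add: paratopological_group_def)
  have "U \<subseteq> carrier G"
    using openin_subset[OF U] top by simp
  have "(\<lambda>x. a \<otimes>\<^bsub>G\<^esub> x) ` U = {x \<in> topspace T. inv\<^bsub>G\<^esub> a \<otimes>\<^bsub>G\<^esub> x \<in> U}" (is "?L = ?R")
  proof
    show "?L \<subseteq> ?R"
      using \<open>U \<subseteq> carrier G\<close> a top by (auto simp: m_assoc[symmetric] subsetD)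
    show "?R \<subseteq> ?L"
    proof
      fix x assume x: "x \<in> ?R"
      then have "x = a \<otimes>\<^bsub>G\<^esub> (inv\<^bsub>G\<^esub> a \<otimes>\<^bsub>G\<^esub> x)"
        using a top by (simp add: m_assoc[symmetric])
      then show "x \<in> ?L"
        using x by blast
    qed
  qed
  then show ?thesis
    using openin_continuous_map_preimage[OF paratopological_group_left_translation[OF pg] U] a
    by simp
qed

text \<open>The product is a union of left translates of \<open>U\<close>. As \<open>A\<close> is
  arbitrary, it may later be the closure of an open set.\<close>

lemma openin_set_mult_right:
  assumes pg: "paratopological_group G T" and "A \<subseteq> carrier G" and U: "openin T U"
  shows "openin T (set_mult G A U)"
proof -
  have "set_mult G A U = (\<Union>a\<in>A. (\<lambda>x. a \<otimes>\<^bsub>G\<^esub> x) ` U)"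
    unfolding set_mult_def by blast
  then show ?thesis
    using openin_left_translation_image[OF pg _ U] assms(2) by (auto simp: subset_iff)
qed

section \<open>Closures of products and the semiregularized group\<close>

lemma set_mult_closure_of_subset:
  assumes "paratopological_group G T"
  shows "set_mult G (T closure_of A) (T closure_of B) \<subseteq> T closure_of (set_mult G A B)"
proof -
  have "(\<lambda>(x, y). x \<otimes>\<^bsub>G\<^esub> y) ` (prod_topology T T closure_of (A \<times> B))
      \<subseteq> T closure_of ((\<lambda>(x, y). x \<otimes>\<^bsub>G\<^esub> y) ` (A \<times> B))"
    using assms unfolding paratopological_group_def
    by (intro continuous_map_image_closure_subset) blast
  moreover have "(\<lambda>(x, y). x \<otimes>\<^bsub>G\<^esub> y) ` (X \<times> Y) = set_mult G X Y" for X Y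
    unfolding set_mult_def by auto
  ultimately show ?thesis
    by (simp add: closure_of_Times)
qed

lemma paratopological_group_closure_nbhd:
  assumes pg: "paratopological_group G T" and U: "openin T U" "x \<in> U"
  obtains V where "openin T V" "x \<in> V" "T closure_of V \<subseteq> T interior_of (T closure_of U)"
proof -
  interpret Group.group G
    using pg by (simp add: paratopological_group_def)
  have top: "topspace T = carrier G"
    using pg by (simp add: paratopological_group_def)
  have x: "x \<in> carrier G"
    using U openin_subset top by blast
  \<comment> \<open>Continuity of multiplication at the pair of \<open>x\<close> and the identity.
    The factor \<open>W\<close> thickens the closure of \<open>V\<close> to an open set inside the
    closure of \<open>U\<close>.\<close>
  then obtain V W where VW: "openin T V" "openin T W" "x \<in> V" "\<one>\<^bsub>G\<^esub> \<in> W" "set_mult G V W \<subseteq> U"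
    using paratopological_group_mult_nbhds[OF pg U(1) x one_closed] U(2) by auto
  have cl: "T closure_of V \<subseteq> carrier G"
    using closure_of_subset_topspace top by metis
  have "W \<subseteq> T closure_of W"
    using VW(2) by (simp add: closure_of_subset openin_subset)
  then have "set_mult G (T closure_of V) W \<subseteq> set_mult G (T closure_of V) (T closure_of W)"
    unfolding set_mult_def by blast
  also have "\<dots> \<subseteq> T closure_of (set_mult G V W)"
    by (rule set_mult_closure_of_subset[OF pg])
  also have "\<dots> \<subseteq> T closure_of U"
    using VW(5) by (rule closure_of_mono)
  finally have "set_mult G (T closure_of V) W \<subseteq> T interior_of (T closure_of U)"
    using openin_set_mult_right[OF pg cl VW(2)] by (rule interior_of_maximal)
  moreover have "T closure_of V \<subseteq> set_mult G (T closure_of V) W"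
  proof
    fix y assume y: "y \<in> T closure_of V"
    then have "y = y \<otimes>\<^bsub>G\<^esub> \<one>\<^bsub>G\<^esub>"
      using cl by (simp add: subsetD)
    then show "y \<in> set_mult G (T closure_of V) W"
      using y VW(4) unfolding set_mult_def by blast
  qed
  ultimately show thesis
    using that VW(1,3) by blast
qed

text \<open>If \<open>A\<close> times \<open>B\<close> lies in \<open>U\<close>, the product of the
  regular hulls of \<open>A\<close> and \<open>B\<close> lies in the closure of \<open>U\<close>.
  Being open, it lies even in the regular hull of \<open>U\<close>.\<close>

lemma paratopological_group_semiregularization:
  assumes pg: "paratopological_group G T"
  shows "paratopological_group G (semiregularization T)"
proof -
  interpret Group.group G
    using pg by (simp add: paratopological_group_def)
  have top: "topspace T = carrier G"
    using pg by (simp add: paratopological_group_def)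
  let ?R = "semiregularization T" and ?r = "\<lambda>U. T interior_of (T closure_of U)"
  have "openin (prod_topology ?R ?R)
      {p \<in> topspace (prod_topology ?R ?R). (\<lambda>(x, y). x \<otimes>\<^bsub>G\<^esub> y) p \<in> S}" (is "openin _ ?P")
    if S: "openin ?R S" for S
    unfolding openin_prod_topology_alt
  proof (intro allI impI)
    fix x y assume "(x, y) \<in> ?P"
    then have xy: "x \<in> carrier G" "y \<in> carrier G" "x \<otimes>\<^bsub>G\<^esub> y \<in> S"
      using top by auto
    then obtain U where U: "openin T U" "x \<otimes>\<^bsub>G\<^esub> y \<in> U" "?r U \<subseteq> S"
      using S unfolding openin_semiregularization by blast
    obtain A B where AB: "openin T A" "openin T B" "x \<in> A" "y \<in> B" "set_mult G A B \<subseteq> U"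
      using paratopological_group_mult_nbhds[OF pg U(1) xy(1,2) U(2)] by blast
    have sub: "?r A \<subseteq> carrier G" "?r B \<subseteq> carrier G"
      using interior_of_subset_topspace top by metis+
    have "set_mult G (?r A) (?r B) \<subseteq> set_mult G (T closure_of A) (T closure_of B)"
      using interior_of_subset[of T "T closure_of A"] interior_of_subset[of T "T closure_of B"]
      unfolding set_mult_def by blast
    also have "\<dots> \<subseteq> T closure_of (set_mult G A B)"
      by (rule set_mult_closure_of_subset[OF pg])
    also have "\<dots> \<subseteq> T closure_of U"
      using AB(5) by (rule closure_of_mono)
    finally have "set_mult G (?r A) (?r B) \<subseteq> ?r U"
      using openin_set_mult_right[OF pg sub(1) openin_interior_of] by (rule interior_of_maximal)
    then have "?r A \<times> ?r B \<subseteq> ?P"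
      using U(3) sub top unfolding set_mult_def by (auto simp: subset_iff)
    moreover have "x \<in> ?r A" "y \<in> ?r B"
      using AB subset_interior_closure by blast+
    ultimately show "\<exists>A B. openin ?R A \<and> openin ?R B \<and> x \<in> A \<and> y \<in> B \<and> A \<times> B \<subseteq> ?P"
      using AB(1,2) openin_semiregularization_interior_closure by blast
  qed
  then show ?thesis
    using pg unfolding paratopological_group_def continuous_map_def by auto
qed

section \<open>Continuity of inversion, and comparison with a coarser compact topology\<close>

lemma compact_Hausdorff_imp_topological_group:
  assumes pg: "paratopological_group G T" and "Hausdorff_space T" "compact_space T"
  shows "topological_group G T"
proof -
  interpret Group.group G
    using pg by (simp add: paratopological_group_def)
  have top: "topspace T = carrier G"
    and cont: "continuous_map (prod_topology T T) T (\<lambda>(x, y). x \<otimes>\<^bsub>G\<^esub> y)"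
    using pg by (auto simp: paratopological_group_def)
  \<comment> \<open>The graph of inversion, written as the preimage of a closed point under
    multiplication.\<close>
  let ?\<Gamma> = "{p \<in> topspace (prod_topology T T). (\<lambda>(x, y). x \<otimes>\<^bsub>G\<^esub> y) p \<in> {\<one>\<^bsub>G\<^esub>}}"
  have "closedin T {\<one>\<^bsub>G\<^esub>}"
    using assms(2) top by (simp add: closedin_Hausdorff_singleton)
  then have \<Gamma>: "closedin (prod_topology T T) ?\<Gamma>"
    using cont by (intro closedin_continuous_map_preimage)
  have "closedin T {x \<in> topspace T. inv\<^bsub>G\<^esub> x \<in> C}" if C: "closedin T C" for C
  proof -
    have "C \<subseteq> carrier G"
      using closedin_subset[OF C] top by simp
    have "closedin (prod_topology T T) (?\<Gamma> \<inter> topspace T \<times> C)"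
      using \<Gamma> C by (intro closedin_Int) (simp_all add: closedin_prod_Times_iff)
    \<comment> \<open>Projection along a compact factor is a closed map.\<close>
    then have "closedin T (fst ` (?\<Gamma> \<inter> topspace T \<times> C))"
      using Abstract_Topological_Spaces.closed_map_fst[OF assms(3)] unfolding closed_map_def by blast
    moreover have "fst ` (?\<Gamma> \<inter> topspace T \<times> C) = {x \<in> topspace T. inv\<^bsub>G\<^esub> x \<in> C}"
    proof (intro subset_antisym subsetI)
      fix x assume "x \<in> fst ` (?\<Gamma> \<inter> topspace T \<times> C)"
      then obtain y where y: "x \<in> carrier G" "y \<in> C" "x \<otimes>\<^bsub>G\<^esub> y = \<one>\<^bsub>G\<^esub>"
        using top by auto
      moreover have "y \<in> carrier G"
        using y(2) \<open>C \<subseteq> carrier G\<close> by blast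
      ultimately have "inv\<^bsub>G\<^esub> x = y"
        by (simp add: inv_comm inv_equality)
      then show "x \<in> {x \<in> topspace T. inv\<^bsub>G\<^esub> x \<in> C}"
        using y top by simp
    next
      fix x assume "x \<in> {x \<in> topspace T. inv\<^bsub>G\<^esub> x \<in> C}"
      then have "(x, inv\<^bsub>G\<^esub> x) \<in> ?\<Gamma> \<inter> topspace T \<times> C"
        using top by auto
      then show "x \<in> fst ` (?\<Gamma> \<inter> topspace T \<times> C)"
        by force
    qed
    ultimately show ?thesis
      by simp
  qed
  then show ?thesis
    unfolding topological_group_def continuous_map_closedin using pg top by simp
qed

text \<open>On a \<open>T\<close>-compact set \<open>K\<close> the topologies agree: a relatively
  \<open>T\<close>-closed subset is \<open>T\<close>-compact, hence \<open>R\<close>-compact, hence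
  \<open>R\<close>-closed. Baire provides such a \<open>K\<close> with non-empty
  \<open>R\<close>-interior, and translations carry the agreement to every point.\<close>

lemma paratopological_group_eq_coarser_Baire:
  assumes pgT: "paratopological_group G T" and pgR: "paratopological_group G R"
    and coarser: "\<And>S. openin R S \<Longrightarrow> openin T S"
    and R: "Hausdorff_space R" "compact_space R" and "sigma_compact_space T"
  shows "T = R"
proof -
  interpret Group.group G
    using pgT by (simp add: paratopological_group_def)
  have top: "topspace T = carrier G" "topspace R = carrier G"
    using pgT pgR by (auto simp: paratopological_group_def)
  have compact: "compactin R K" if "compactin T K" for K
    using that coarser unfolding compactin_def top by simp
  obtain \<K> where \<K>: "countable \<K>" "\<And>K. K \<in> \<K> \<Longrightarrow> compactin T K" "\<Union>\<K> = topspace T"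
    using assms(6) unfolding sigma_compact_space_def by metis
  have "\<exists>K\<in>\<K>. R interior_of K \<noteq> {}"
  proof (rule ccontr)
    assume no: "\<not> (\<exists>K\<in>\<K>. R interior_of K \<noteq> {})"
    have "R interior_of \<Union>\<K> = {}"
    proof (rule Baire_category_alt)
      show "completely_metrizable_space R \<or> locally_compact_space R \<and> regular_space R"
        using R by (simp add: compact_Hausdorff_imp_regular_space compact_imp_locally_compact_space)
      show "closedin R K \<and> R interior_of K = {}" if "K \<in> \<K>" for K
        using that no \<K>(2) R(1) compact compactin_imp_closedin by blast
    qed (rule \<K>(1))
    then have "carrier G = {}"
      using \<K>(3) top interior_of_topspace[of R] by simp
    then show False
      using one_closed by blast
  qed
  then obtain K u where K: "K \<in> \<K>" and u: "u \<in> R interior_of K"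
    by blast
  let ?I = "R interior_of K"
  have u_carrier: "u \<in> carrier G"
    using u interior_of_subset_topspace[of R K] top by blast
  have "openin R S" if S: "openin T S" for S
  proof (subst openin_subopen, intro ballI)
    fix x assume x: "x \<in> S"
    then have x_carrier: "x \<in> carrier G"
      using openin_subset[OF S] top by blast
    \<comment> \<open>Translation by \<open>a\<close> moves \<open>x\<close> to the point
      \<open>u\<close>, where the topologies can be compared inside \<open>K\<close>.\<close>
    define a where "a = u \<otimes>\<^bsub>G\<^esub> inv\<^bsub>G\<^esub> x"
    have a: "a \<in> carrier G" "a \<otimes>\<^bsub>G\<^esub> x = u" "inv\<^bsub>G\<^esub> a \<otimes>\<^bsub>G\<^esub> u = x"
      using u_carrier x_carrier by (simp_all add: a_def m_assoc inv_mult_group)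
    let ?S = "(\<lambda>y. a \<otimes>\<^bsub>G\<^esub> y) ` S"
    have "openin T ?S"
      using openin_left_translation_image[OF pgT a(1) S] .
    then have "compactin T ((topspace T - ?S) \<inter> K)"
      using \<K>(2)[OF K] by (intro closed_Int_compactin) auto
    moreover have "(topspace T - ?S) \<inter> K = K - ?S"
      using compactin_subset_topspace[OF \<K>(2)[OF K]] by blast
    ultimately have "compactin T (K - ?S)"
      by simp
    \<comment> \<open>Since \<open>?I\<close> lies in \<open>K\<close>, this difference is
      \<open>?I \<inter> ?S\<close>, now seen to be open in \<open>R\<close>. Translating it back by
      the inverse of \<open>a\<close> gives an \<open>R\<close>-neighbourhood of \<open>x\<close>
      inside \<open>S\<close>.\<close>
    then have "openin R (?I - (K - ?S))"
      by (intro openin_diff openin_interior_of compactin_imp_closedin[OF R(1)] compact)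
    then have "openin R ((\<lambda>y. inv\<^bsub>G\<^esub> a \<otimes>\<^bsub>G\<^esub> y) ` (?I - (K - ?S)))" (is "openin R ?V")
      using a(1) by (intro openin_left_translation_image[OF pgR]) auto
    moreover have "x \<in> ?V"
    proof -
      have "u \<in> ?I - (K - ?S)"
        using u a(2) x by blast
      then show ?thesis
        using a(3) by (metis imageI)
    qed
    moreover have "?V \<subseteq> S"
    proof
      fix y assume "y \<in> ?V"
      then obtain s where "s \<in> S" "y = inv\<^bsub>G\<^esub> a \<otimes>\<^bsub>G\<^esub> (a \<otimes>\<^bsub>G\<^esub> s)"
        using interior_of_subset[of R K] by blast
      then show "y \<in> S"
        using a(1) openin_subset[OF S] top by (simp add: m_assoc[symmetric] subsetD)
    qed
    ultimately show "\<exists>V. openin R V \<and> x \<in> V \<and> V \<subseteq> S"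
      by blast
  qed
  then show ?thesis
    using coarser by (auto simp: topology_eq)
qed

theorem proposition3p34:
  fixes G :: "('a, 'b) monoid_scheme" and T :: "'a topology"
  assumes "paratopological_group G T"
    and "Hausdorff_space T"
    and "sigma_compact_space T"
    and "feebly_compact_space T"
  shows "compact_space T \<and> topological_group G T"
proof -
  have compact: "compact_space (semiregularization T)"
    using assms(4) sigma_compact_imp_Lindelof_space[OF assms(3)]
    by (rule compact_space_semiregularization)
      (meson paratopological_group_closure_nbhd[OF assms(1)])
  \<comment> \<open>With this equality the compactness just shown becomes compactness of
    \<open>T\<close> itself.\<close>
  have "T = semiregularization T"
    by (rule paratopological_group_eq_coarser_Baire[OF assms(1) _ _ _ compact assms(3)])
      (use assms in \<open>simp_all add: paratopological_group_semiregularization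
        openin_semiregularization_imp_openin Hausdorff_space_semiregularization\<close>)
  then show ?thesis
    using compact compact_Hausdorff_imp_topological_group[OF assms(1,2)] by simp
qed

end
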